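(* Let $0<R\le\infty$, let $A$ and $B$ be $C^1$ functions on $(0,R)$ and let $$C(r)=(A(r)B(r))'+(N-1)\frac{A(r)B(r)}{r}-B^2(r).$$ Then for all $u\in C_0^\infty(B_R\setminus\{0\})$, we have $$\left(\int_{B_R}A^2(|x|)|\mathcal{R}u|^2dx\right)^{\frac12}\left(\int_{B_R}B^2(|x|)|u|^2dx\right)^{\frac12}=\frac12\int_{B_R}\left[C(|x|)+B^2(|x|)\right]|u|^2dx+\frac12\int_{B_R}\left|\frac{\|Bu\|_2^{1/2}}{\|A\mathcal{R}u\|_2^{1/2}}A(|x|)\mathcal{R}u+\frac{\|A\mathcal{R}u\|_2^{1/2}}{\|Bu\|_2^{1/2}}B(|x|)u\right|^2dx$$ and $$\left(\int_{B_R}A^2(|x|)|\nabla u|^2dx\right)^{\frac12}\left(\int_{B_R}B^2(|x|)|u|^2dx\right)^{\frac12}=\frac12\int_{B_R}\left[C(|x|)+B^2(|x|)\right]|u|^2dx+\frac12\int_{B_R}\left|\frac{\|Bu\|_2^{1/2}}{\|A|\nabla u|\|_2^{1/2}}A(|x|)\nabla u+\frac{\|A|\nabla u|\|_2^{1/2}}{\|Bu\|_2^{1/2}}B(|x|)u\frac{x}{|x|}\right|^2dx.$$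
   Context: All functions are real-valued. $N$ is the dimension of the space $\mathbb{R}^N$, $B_R$ is the open ball of radius $R$ centered at the origin in $\mathbb{R}^N$ ($B_\infty=\mathbb{R}^N$), $\mathcal{R}u(x):=\frac{x}{|x|}\cdot\nabla u(x)$ is the radial derivative, $\|\cdot\|_2$ is the $L^2(B_R)$ norm, and $A,B$ inside norms stand for $A(|x|),B(|x|)$. *)

theory Defs
  imports "HOL-Analysis.Analysis"
begin

text \<open>The radius is an extended real, so that \<open>eball0 \<infinity>\<close> is the whole space.\<close>

definition eball0 :: "ereal \<Rightarrow> 'a::real_normed_vector set"
  where "eball0 R = {x. ereal (norm x) < R}"

definition grad :: "('a::euclidean_space \<Rightarrow> real) \<Rightarrow> 'a \<Rightarrow> 'a"
  where "grad u x = (\<Sum>i\<in>Basis. frechet_derivative u (at x) i *\<^sub>R i)"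

definition radial_deriv :: "('a::euclidean_space \<Rightarrow> real) \<Rightarrow> 'a \<Rightarrow> real"
  where "radial_deriv u x = (x /\<^sub>R norm x) \<bullet> grad u x"

definition L2norm_on :: "'a::euclidean_space set \<Rightarrow> ('a \<Rightarrow> 'b::real_normed_vector) \<Rightarrow> real"
  where "L2norm_on S f = sqrt (LINT x:S|lborel. (norm (f x))\<^sup>2)"

text \<open>\<open>Ck_on k S f\<close>: all partial derivatives of \<open>f\<close> up to order \<open>k\<close> exist and are continuous
  on \<open>S\<close>. Meant for open \<open>S\<close> only, since derivatives are taken in the full space.\<close>

fun Ck_on :: "nat \<Rightarrow> 'a::euclidean_space set \<Rightarrow> ('a \<Rightarrow> real) \<Rightarrow> bool"
  where
    "Ck_on 0 S f \<longleftrightarrow> continuous_on S f"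
  | "Ck_on (Suc k) S f \<longleftrightarrow> (\<forall>x\<in>S. f differentiable (at x)) \<and>
       (\<forall>i\<in>Basis. Ck_on k S (\<lambda>x. frechet_derivative f (at x) i))"

text \<open>Elements of \<open>C\<^sub>0\<^sup>\<infinity>(\<Omega>)\<close>, for open \<open>\<Omega>\<close>, are represented by their extensions by zero to the
  whole space.\<close>

definition test_functions :: "'a::euclidean_space set \<Rightarrow> ('a \<Rightarrow> real) set"
  where "test_functions \<Omega> = {u. (\<forall>k. Ck_on k \<Omega> u) \<and>
     compact (closure {x. u x \<noteq> 0}) \<and> closure {x. u x \<noteq> 0} \<subseteq> \<Omega>}"

end

theory Submission
  imports Defs
begin

text \<open>Expanding the square in the last integral turns each identity into
  \<open>\<integral> A B u \<R>u = - 1/2 \<integral> (C + B\<^sup>2) u\<^sup>2\<close>. This is the statement that the compactly supported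
  \<open>C\<^sup>1\<close> vector field \<open>A(|x|) B(|x|) u\<^sup>2 x / |x|\<close> has a divergence with integral zero.\<close>

section \<open>Functions with compact support: integrability and derivatives\<close>

lemma integrable_compact_support:
  fixes f :: "'a::euclidean_space \<Rightarrow> 'b::{banach, second_countable_topology}"
  assumes "compact K" "continuous_on K f" "\<And>x. x \<notin> K \<Longrightarrow> f x = 0"
  shows "integrable lborel f"
proof -
  have "(\<lambda>x. indicator K x *\<^sub>R f x) = f"
    using assms(3) by (auto simp: indicator_def)
  with borel_integrable_compact[OF assms(1,2)] show ?thesis by simp
qed

text \<open>The complement of \<open>K\<close> is open, so \<open>f\<close> is locally zero at
  \<open>x\<close>. This handles all points off the support, where coefficients may be singular or
  undefined.\<close>

lemma has_derivative_zero_outside_closed: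
  fixes f :: "'a::real_normed_vector \<Rightarrow> 'b::real_normed_vector"
  assumes "closed K" "\<And>x. x \<notin> K \<Longrightarrow> f x = 0" "x \<notin> K"
  shows "(f has_derivative (\<lambda>_. 0)) (at x)"
  by (rule has_derivative_transform_within_open[of "\<lambda>_. 0" _ _ _ "- K"])
    (use assms in auto)

text \<open>Restriction to a line makes difference quotients and the mean value theorem of one
  variable available.\<close>

lemma has_derivative_line:
  fixes h :: "'a::real_normed_vector \<Rightarrow> real"
  assumes "(h has_derivative h') (at (x + t *\<^sub>R e))"
  shows "((\<lambda>t. h (x + t *\<^sub>R e)) has_real_derivative h' e) (at t)"
proof -
  have "((\<lambda>t. h (x + t *\<^sub>R e)) has_derivative (\<lambda>s. h' (s *\<^sub>R e))) (at t)"
    by (rule has_derivative_compose[where f = "\<lambda>t. x + t *\<^sub>R e" and g = h and g' = h'])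
      (use assms in \<open>auto intro!: derivative_eq_intros\<close>)
  moreover have "(\<lambda>s. h' (s *\<^sub>R e)) = (*) (h' e)"
    using has_derivative_linear[OF assms] by (auto simp: linear_cmul)
  ultimately show ?thesis
    by (simp add: has_field_derivative_def)
qed

section \<open>Directional derivatives with compact support have integral zero\<close>

text \<open>Translation invariance makes every difference quotient integrate to zero; the mean value
  theorem dominates the quotients, which yields the claim without Fubini.\<close>

lemma integral_directional_derivative_eq_0:
  fixes h :: "'a::euclidean_space \<Rightarrow> real"
  assumes K: "compact K" and supp: "\<And>x. x \<notin> K \<Longrightarrow> h x = 0"
    and h: "\<And>x. (h has_derivative h' x) (at x)"
    and cont: "continuous_on K (\<lambda>x. h' x e)"
  shows "integrable lborel (\<lambda>x. h' x e)" "(LINT x|lborel. h' x e) = 0"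
proof -
  have supp': "h' x e = 0" if "x \<notin> K" for x
    using has_derivative_unique[OF h has_derivative_zero_outside_closed[of K h x]] that supp
      compact_imp_closed[OF K] by metis
  show int': "integrable lborel (\<lambda>x. h' x e)"
    by (rule integrable_compact_support[OF K cont supp'])
  have "continuous_on UNIV h"
    using h by (meson continuous_at_imp_continuous_on has_derivative_continuous)
  then have [measurable]: "h \<in> borel_measurable borel"
    by (rule borel_measurable_continuous_onI)
  have int: "integrable lborel h"
    using \<open>continuous_on UNIV h\<close> continuous_on_subset
    by (intro integrable_compact_support[OF K _ supp]) auto
  obtain r where r: "\<And>x. x \<in> K \<Longrightarrow> norm x \<le> r"
    using compact_imp_bounded[OF K] by (auto simp: bounded_iff)
  have "bounded ((\<lambda>x. h' x e) ` K)"
    using K cont by (intro compact_imp_bounded compact_continuous_image)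
  then obtain M0 where M0: "\<And>x. x \<in> K \<Longrightarrow> \<bar>h' x e\<bar> \<le> M0"
    by (auto simp: bounded_iff)
  \<comment> \<open>The maximum with 0 keeps the bound valid off \<open>K\<close>, where the
    derivative is zero, even if \<open>K\<close> is empty and \<open>M0\<close> is negative.\<close>
  define M where "M = max M0 0"
  have M: "\<bar>h' x e\<bar> \<le> M" for x
    using M0[of x] supp'[of x] by (cases "x \<in> K") (auto simp: M_def)
  \<comment> \<open>The steps tend to 0 and never exceed 1, so that all shifted supports stay in one
    bounded set.\<close>
  define t where "t n = inverse (real (Suc n))" for n
  have t: "0 < t n" "t n \<le> 1" for n
    by (auto simp: t_def inverse_le_1_iff)
  define s where "s n x = (h (x + t n *\<^sub>R e) - h x) / t n" for n x
  have shift: "integral\<^sup>L lborel (s n) = 0" for n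
  proof -
    have d: "distr lborel borel ((+) (t n *\<^sub>R e)) = lborel"
      by (rule lborel_distr_plus)
    have "integrable (distr lborel borel ((+) (t n *\<^sub>R e))) h"
      using int unfolding d .
    then have i: "integrable lborel (\<lambda>x. h (x + t n *\<^sub>R e))"
      by (subst (asm) integrable_distr_eq) (auto simp: add.commute)
    have "integral\<^sup>L lborel h = integral\<^sup>L (distr lborel borel ((+) (t n *\<^sub>R e))) h"
      unfolding d ..
    also have "\<dots> = (LINT x|lborel. h (x + t n *\<^sub>R e))"
      by (subst integral_distr) (auto simp: add.commute)
    finally show ?thesis
      unfolding s_def using i int by simp
  qed
  have "(\<lambda>n. integral\<^sup>L lborel (s n)) \<longlonglongrightarrow> (LINT x|lborel. h' x e)"
  \<comment> \<open>The ball of radius \<open>r + norm e\<close> contains every \<open>x\<close> for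
    which \<open>x\<close> or some \<open>x + t n *\<^sub>R e\<close> lies in \<open>K\<close>;
    there the quotients are bounded by \<open>M\<close>.\<close>
  proof (rule integral_dominated_convergence[where
        w = "\<lambda>x. indicator (cball 0 (r + norm e)) x *\<^sub>R M"])
    show "(\<lambda>x. h' x e) \<in> borel_measurable lborel"
      using int' by simp
    show "s n \<in> borel_measurable lborel" for n
      unfolding s_def by measurable
    show "integrable lborel (\<lambda>x. indicator (cball 0 (r + norm e)) x *\<^sub>R M :: real)"
      by (rule borel_integrable_compact) auto
    have "filterlim t (at 0) sequentially"
      unfolding t_def using LIMSEQ_inverse_real_of_nat by (intro filterlim_atI) auto
    moreover have "((\<lambda>t. (h (x + t *\<^sub>R e) - h x) / t) \<longlongrightarrow> h' x e) (at 0)" for x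
      using has_derivative_line[of h "h' x" x 0 e] h[of x] by (simp add: DERIV_def)
    ultimately show "AE x in lborel. (\<lambda>n. s n x) \<longlonglongrightarrow> h' x e"
      unfolding s_def by (intro AE_I2) (rule filterlim_compose)
    have "norm (s n x) \<le> indicator (cball 0 (r + norm e)) x *\<^sub>R M" for n x
    proof (cases "x \<in> cball 0 (r + norm e)")
      case True
      \<comment> \<open>The location of \<open>z\<close> does not matter, because \<open>M\<close>
        bounds the derivative everywhere.\<close>
      obtain z where "h (x + t n *\<^sub>R e) - h x = t n * h' (x + z *\<^sub>R e) e"
        using MVT2[OF t(1)[of n], of "\<lambda>t. h (x + t *\<^sub>R e)" "\<lambda>t. h' (x + t *\<^sub>R e) e"]
          has_derivative_line[OF h] by auto
      then have "s n x = h' (x + z *\<^sub>R e) e"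
        using t(1)[of n] by (simp add: s_def)
      with M True show ?thesis by simp
    next
      case False
      then have *: "r + norm e < norm x" by simp
      have "norm x \<le> norm (x + t n *\<^sub>R e) + t n * norm e"
        using norm_triangle_ineq4[of "x + t n *\<^sub>R e" "t n *\<^sub>R e"] t(1)[of n] by simp
      moreover have "t n * norm e \<le> norm e"
        using t[of n] by (intro mult_left_le_one_le) auto
      ultimately have "r < norm (x + t n *\<^sub>R e)" using * by simp
      moreover have "r < norm x" using * norm_ge_zero[of e] by linarith
      ultimately have "x \<notin> K" "x + t n *\<^sub>R e \<notin> K" using r by fastforce+
      then show ?thesis using False by (simp add: s_def supp)
    qed
    then show "AE x in lborel. norm (s n x) \<le> indicator (cball 0 (r + norm e)) x *\<^sub>R M" for n
      by simp
  qed
  \<comment> \<open>The integrals of the quotients form the constant sequence 0, so their limit is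
    0.\<close>
  then show "(LINT x|lborel. h' x e) = 0"
    unfolding shift by (simp add: LIMSEQ_const_iff)
qed

section \<open>Completing the square for a product of two norms\<close>

text \<open>In the degenerate cases one of \<open>f\<close>, \<open>w\<close> vanishes almost everywhere, while the junk value
  \<open>x / 0 = 0\<close> makes the last integrand vanish.\<close>

lemma L2_product_identity:
  fixes f w :: "'a \<Rightarrow> 'b::euclidean_space"
  assumes f: "integrable M (\<lambda>x. (norm (f x))\<^sup>2)" and w: "integrable M (\<lambda>x. (norm (w x))\<^sup>2)"
    and fw: "integrable M (\<lambda>x. f x \<bullet> w x)"
  defines "a \<equiv> sqrt (LINT x|M. (norm (f x))\<^sup>2)" and "b \<equiv> sqrt (LINT x|M. (norm (w x))\<^sup>2)"
  shows "a * b = - (LINT x|M. f x \<bullet> w x)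
    + 1 / 2 * (LINT x|M. (norm ((sqrt b / sqrt a) *\<^sub>R f x + (sqrt a / sqrt b) *\<^sub>R w x))\<^sup>2)"
proof -
  have a2: "(LINT x|M. (norm (f x))\<^sup>2) = a\<^sup>2" and b2: "(LINT x|M. (norm (w x))\<^sup>2) = b\<^sup>2"
    and ab: "0 \<le> a" "0 \<le> b"
    by (auto simp: a_def b_def)
  show ?thesis
  proof (cases "a = 0 \<or> b = 0")
    case True
    have zero: "AE x in M. g x = 0"
      if "(LINT x|M. (norm (g x))\<^sup>2) = 0" "integrable M (\<lambda>x. (norm (g x))\<^sup>2)" for g :: "'a \<Rightarrow> 'b"
      using integral_nonneg_eq_0_iff_AE[OF that(2)] that(1) by simp
    have "AE x in M. f x \<bullet> w x = 0"
      using True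
    proof
      assume "a = 0"
      then show ?thesis using zero[OF _ f] a2 by auto
    next
      assume "b = 0"
      then show ?thesis using zero[OF _ w] b2 by auto
    qed
    then have "(LINT x|M. f x \<bullet> w x) = 0"
      by (rule integral_eq_zero_AE)
    with True show ?thesis by auto
  next
    case False
    then have pos: "0 < a" "0 < b" using ab by auto
    have "(norm ((sqrt b / sqrt a) *\<^sub>R f x + (sqrt a / sqrt b) *\<^sub>R w x))\<^sup>2
      = b / a * (norm (f x))\<^sup>2 + a / b * (norm (w x))\<^sup>2 + 2 * (f x \<bullet> w x)" for x
    proof -
      \<comment> \<open>With \<open>c = sqrt b / sqrt a\<close> and
        \<open>d = sqrt a / sqrt b\<close>, the square weights are \<open>b / a\<close> and
        \<open>a / b\<close>, and \<open>c * d = 1\<close>.\<close>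
      have "(norm (c *\<^sub>R f x + d *\<^sub>R w x))\<^sup>2
        = c\<^sup>2 * (norm (f x))\<^sup>2 + d\<^sup>2 * (norm (w x))\<^sup>2 + 2 * (c * d) * (f x \<bullet> w x)" for c d
        by (simp add: power2_norm_eq_inner inner_add_left inner_add_right inner_commute
            algebra_simps) (simp add: power2_eq_square)
      then show ?thesis using pos by (simp add: power_divide)
    qed
    then have "(LINT x|M. (norm ((sqrt b / sqrt a) *\<^sub>R f x + (sqrt a / sqrt b) *\<^sub>R w x))\<^sup>2)
      = b / a * a\<^sup>2 + a / b * b\<^sup>2 + 2 * (LINT x|M. f x \<bullet> w x)"
      using f w fw by (simp add: a2 b2)
    also have "\<dots> = 2 * (a * b) + 2 * (LINT x|M. f x \<bullet> w x)"
      using pos by (simp add: power2_eq_square)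
    finally show ?thesis by (simp add: add_divide_distrib)
  qed
qed

section \<open>Divergence of radial vector fields\<close>

text \<open>The integrand is the divergence of \<open>g(|x|) v(x) x / |x|\<close>.\<close>

lemma integral_radial_divergence_eq_0:
  fixes v :: "'a::euclidean_space \<Rightarrow> real"
  assumes K: "compact K" "K \<subseteq> {x. norm x \<in> I}" and I: "I \<subseteq> {0<..}"
    and g: "\<And>r. r \<in> I \<Longrightarrow> (g has_real_derivative g' r) (at r)" "continuous_on I g'"
    and v: "\<And>x. (v has_derivative v' x) (at x)" "\<And>x. x \<notin> K \<Longrightarrow> v x = 0"
    and v': "\<And>i. i \<in> Basis \<Longrightarrow> continuous_on K (\<lambda>x. v' x i)"
  shows "(LINT x|lborel. (g' (norm x) + (real DIM('a) - 1) * (g (norm x) / norm x)) * v x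
    + g (norm x) * v' x (x /\<^sub>R norm x)) = 0"
proof -
  \<comment> \<open>\<open>P i x k\<close> is the derivative in direction \<open>k\<close> of the
    \<open>i\<close>-th component of the field. The quotient rule is applied to
    \<open>g(r) / r\<close>, and \<open>sgn x\<close> is the gradient of the norm. The trace over
    \<open>i\<close> is the divergence.\<close>
  define P where "P i x k = ((g' (norm x) * norm x - g (norm x)) * (sgn x \<bullet> k) / (norm x)\<^sup>2 * (x \<bullet> i)
    + g (norm x) / norm x * (k \<bullet> i)) * v x + g (norm x) / norm x * (x \<bullet> i) * v' x k" for i x k :: 'a
  have nz: "x \<noteq> 0" "norm x \<in> I" if "x \<in> K" for x
    using that K(2) I by auto
  have v'0: "v' x = (\<lambda>_. 0)" if "x \<notin> K" for x
    using has_derivative_unique[OF v(1) has_derivative_zero_outside_closed[of K v x]] that v(2)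
      compact_imp_closed[OF K(1)] by metis
  have P: "((\<lambda>x. g (norm x) / norm x * (x \<bullet> i) * v x) has_derivative P i x) (at x)" for i x
  \<comment> \<open>On \<open>K\<close> the norm is positive, hence differentiable. Off
    \<open>K\<close>, in particular at the origin, the component is locally zero.\<close>
  proof (cases "x \<in> K")
    case True
    note [derivative_intros] = has_derivative_norm[OF nz(1)[OF True]]
      DERIV_compose_FDERIV[OF g(1)[OF nz(2)[OF True]] has_derivative_norm[OF nz(1)[OF True]]]
      v(1)[of x]
    show ?thesis
      unfolding P_def using nz(1)[OF True]
      by (auto intro!: derivative_eq_intros simp: fun_eq_iff divide_simps inner_commute)
        (simp add: algebra_simps power2_eq_square)
  next
    case False
    have "P i x = (\<lambda>_. 0)"
      by (auto simp: fun_eq_iff P_def v'0[OF False] v(2)[OF False])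
    then show ?thesis
      using False v(2) compact_imp_closed[OF K(1)]
      by (auto intro!: has_derivative_zero_outside_closed[of K])
  qed
  have "continuous_on I g"
    using g(1) by (meson DERIV_continuous continuous_at_imp_continuous_on)
  moreover have "continuous_on K (\<lambda>x. f (norm x))" if "continuous_on I f" for f :: "real \<Rightarrow> real"
    using nz(2) by (intro continuous_on_compose2[OF that] continuous_intros) auto
  ultimately have [continuous_intros]:
    "continuous_on K (\<lambda>x. g (norm x))" "continuous_on K (\<lambda>x. g' (norm x))"
    using g(2) by auto
  have [continuous_intros]: "continuous_on K v"
    using v(1) by (meson continuous_at_imp_continuous_on has_derivative_continuous)
  have contP: "continuous_on K (\<lambda>x. P i x i)" if "i \<in> Basis" for i
    unfolding P_def sgn_div_norm
    by (intro continuous_intros v' that) (auto dest: nz)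
  have z: "integrable lborel (\<lambda>x. P i x i)" "(LINT x|lborel. P i x i) = 0" if "i \<in> Basis" for i
    by (rule integral_directional_derivative_eq_0[OF K(1) _ P contP]; use v(2) that in simp)+
  \<comment> \<open>The derivative of \<open>g(r) / r\<close> contributes \<open>g' - g / r\<close>
    and the derivatives of the coordinates contribute \<open>g / r\<close> once per dimension, which
    leaves the factor \<open>DIM('a) - 1\<close>.\<close>
  have "(\<Sum>i\<in>Basis. P i x i) = (g' (norm x) + (real DIM('a) - 1) * (g (norm x) / norm x)) * v x
    + g (norm x) * v' x (x /\<^sub>R norm x)" for x
  proof (cases "x \<in> K")
    case True
    define r where "r = norm x"
    have r: "r \<noteq> 0" using nz(1)[OF True] by (simp add: r_def)
    have s: "(\<Sum>i\<in>Basis. (x \<bullet> i) * (x \<bullet> i)) = r\<^sup>2"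
      by (simp add: r_def power2_norm_eq_inner euclidean_inner[of x x])
    have lin: "linear (v' x)" using v(1) by (rule has_derivative_linear)
    have "v' x x = v' x (\<Sum>i\<in>Basis. (x \<bullet> i) *\<^sub>R i)" by (simp add: euclidean_representation)
    also have "\<dots> = (\<Sum>i\<in>Basis. (x \<bullet> i) * v' x i)"
      using lin by (simp add: linear_sum linear_cmul)
    finally have lx: "(\<Sum>i\<in>Basis. (x \<bullet> i) * v' x i) = v' x x" ..
    have "(\<Sum>i\<in>Basis. P i x i) = (\<Sum>i\<in>Basis. (g' r * r - g r) / r ^ 3 * v x * ((x \<bullet> i) * (x \<bullet> i))
        + g r / r * v x + g r / r * ((x \<bullet> i) * v' x i))"
      unfolding P_def r_def[symmetric]
      by (intro sum.cong refl)
        (use r in \<open>simp add: sgn_div_norm r_def[symmetric] field_simps power2_eq_square power3_eq_cube\<close>)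
    also have "\<dots> = (g' r * r - g r) / r ^ 3 * v x * r\<^sup>2 + real DIM('a) * (g r / r * v x) + g r / r * v' x x"
      unfolding sum.distrib s[symmetric] lx[symmetric] sum_distrib_left by simp
    also have "\<dots> = (g' r + (real DIM('a) - 1) * (g r / r)) * v x + g r * v' x (x /\<^sub>R r)"
      using r by (simp add: linear_cmul[OF lin] field_simps power2_eq_square power3_eq_cube)
    finally show ?thesis by (simp add: r_def)
  next
    case False
    then show ?thesis by (simp add: P_def v(2) v'0)
  qed
  then have "(LINT x|lborel. (g' (norm x) + (real DIM('a) - 1) * (g (norm x) / norm x)) * v x
    + g (norm x) * v' x (x /\<^sub>R norm x)) = (LINT x|lborel. (\<Sum>i\<in>Basis. P i x i))"
    by simp
  also have "\<dots> = (\<Sum>i\<in>Basis. LINT x|lborel. P i x i)"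
    using z(1) by (intro Bochner_Integration.integral_sum) auto
  also have "\<dots> = 0" using z(2) by simp
  finally show ?thesis .
qed

section \<open>From the vanishing divergence integral to the two product identities\<close>

theorem theorem2p2:
  fixes R :: ereal and A B C :: "real \<Rightarrow> real" and u :: "real ^ 'n \<Rightarrow> real"
  assumes "0 < R"
    and "A C1_differentiable_on {r. 0 < r \<and> ereal r < R}"
    and "B C1_differentiable_on {r. 0 < r \<and> ereal r < R}"
    and "\<And>r. 0 < r \<Longrightarrow> ereal r < R \<Longrightarrow>
           C r = deriv (\<lambda>s. A s * B s) r + (real CARD('n) - 1) * (A r * B r / r) - (B r)\<^sup>2"
    and "u \<in> test_functions (eball0 R - {0})"
  defines "nB \<equiv> L2norm_on (eball0 R) (\<lambda>x. B (norm x) * u x)"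
    and "nAR \<equiv> L2norm_on (eball0 R) (\<lambda>x. A (norm x) * radial_deriv u x)"
    and "nAG \<equiv> L2norm_on (eball0 R) (\<lambda>x. A (norm x) * norm (grad u x))"
  shows
    "sqrt (LINT x:eball0 R|lborel. (A (norm x))\<^sup>2 * \<bar>radial_deriv u x\<bar>\<^sup>2)
       * sqrt (LINT x:eball0 R|lborel. (B (norm x))\<^sup>2 * \<bar>u x\<bar>\<^sup>2)
     = 1 / 2 * (LINT x:eball0 R|lborel. (C (norm x) + (B (norm x))\<^sup>2) * \<bar>u x\<bar>\<^sup>2)
       + 1 / 2 * (LINT x:eball0 R|lborel.
           \<bar>sqrt nB / sqrt nAR * A (norm x) * radial_deriv u x
             + sqrt nAR / sqrt nB * B (norm x) * u x\<bar>\<^sup>2)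
     \<and>
     sqrt (LINT x:eball0 R|lborel. (A (norm x))\<^sup>2 * (norm (grad u x))\<^sup>2)
       * sqrt (LINT x:eball0 R|lborel. (B (norm x))\<^sup>2 * \<bar>u x\<bar>\<^sup>2)
     = 1 / 2 * (LINT x:eball0 R|lborel. (C (norm x) + (B (norm x))\<^sup>2) * \<bar>u x\<bar>\<^sup>2)
       + 1 / 2 * (LINT x:eball0 R|lborel.
           (norm ((sqrt nB / sqrt nAG * A (norm x)) *\<^sub>R grad u x
             + (sqrt nAG / sqrt nB * B (norm x) * u x) *\<^sub>R (x /\<^sub>R norm x)))\<^sup>2)"
proof -
  let ?N = "\<lambda>x :: real ^ 'n. norm x"
  let ?S = "eball0 R :: (real ^ 'n) set"
  define I where "I = {r. 0 < r \<and> ereal r < R}"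
  define K where "K = closure {x. u x \<noteq> 0}"
  define D where "D x = frechet_derivative u (at x)" for x
  have K: "compact K" "K \<subseteq> ?S - {0}" and C1: "Ck_on (Suc 0) (?S - {0}) u"
    using assms(5) unfolding test_functions_def K_def by blast+
  have KI: "?N x \<in> I" "x \<noteq> 0" if "x \<in> K" for x
    using that K(2) by (auto simp: I_def eball0_def)
  have u0: "u x = 0" if "x \<notin> K" for x
    using that closure_subset[of "{x. u x \<noteq> 0}"] by (auto simp: K_def)
  have off: "(u has_derivative (\<lambda>_. 0)) (at x)" if "x \<notin> K" for x
    using has_derivative_zero_outside_closed[OF compact_imp_closed[OF K(1)] u0 that] .
  \<comment> \<open>The support lies in the punctured ball, where \<open>u\<close> is smooth;
    elsewhere, including at the origin and beyond the ball, \<open>u\<close> is locally zero. Hence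
    \<open>u\<close> is differentiable on the whole space.\<close>
  have D: "(u has_derivative D x) (at x)" for x
  proof (cases "x \<in> K")
    case True
    then show ?thesis using C1 K(2) by (auto simp: D_def frechet_derivative_works)
  next
    case False
    then show ?thesis
      using off frechet_derivative_works unfolding D_def differentiable_def by blast
  qed
  have D0: "D x = (\<lambda>_. 0)" if "x \<notin> K" for x
    using has_derivative_unique[OF D off[OF that]] .
  have contD: "continuous_on K (\<lambda>x. D x i)" if "i \<in> Basis" for i
    using C1 K(2) that unfolding D_def by (auto intro: continuous_on_subset)
  have contu: "continuous_on K u"
    using D by (meson continuous_at_imp_continuous_on has_derivative_continuous)
  \<comment> \<open>The gradient represents the derivative through the inner product, so
    \<open>radial_deriv\<close> becomes the derivative in the direction
    \<open>x /\<^sub>R norm x\<close>.\<close>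
  have grad: "grad u x \<bullet> h = D x h" for x h
  proof -
    have lin: "linear (D x)" using D by (rule has_derivative_linear)
    have "D x h = D x (\<Sum>i\<in>Basis. (h \<bullet> i) *\<^sub>R i)" by (simp add: euclidean_representation)
    also have "\<dots> = grad u x \<bullet> h"
      using lin by (simp add: linear_sum linear_cmul grad_def D_def inner_sum_left
          inner_commute[of h] mult.commute)
    finally show ?thesis ..
  qed
  have rad: "radial_deriv u x = D x (x /\<^sub>R ?N x)" for x
    by (simp only: radial_deriv_def inner_commute[of "x /\<^sub>R norm x"] grad)
  have grad0: "grad u x = 0" and rad0: "radial_deriv u x = 0" if "x \<notin> K" for x
    using D0[OF that] by (simp_all add: grad_def rad flip: D_def)
  have contg: "continuous_on K (grad u)"
    unfolding grad_def D_def[symmetric] by (intro continuous_intros contD)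
  have contr: "continuous_on K (radial_deriv u)"
    unfolding radial_deriv_def using KI(2) by (intro continuous_intros contg) auto
  obtain A' where A': "\<And>r. r \<in> I \<Longrightarrow> (A has_real_derivative A' r) (at r)" "continuous_on I A'"
    using assms(2) unfolding C1_differentiable_on_def I_def[symmetric]
      has_real_derivative_iff_has_vector_derivative by blast
  obtain B' where B': "\<And>r. r \<in> I \<Longrightarrow> (B has_real_derivative B' r) (at r)" "continuous_on I B'"
    using assms(3) unfolding C1_differentiable_on_def I_def[symmetric]
      has_real_derivative_iff_has_vector_derivative by blast
  have contAB: "continuous_on I A" "continuous_on I B"
    using A'(1) B'(1) by (meson DERIV_continuous continuous_at_imp_continuous_on)+
  have contN: "continuous_on K (\<lambda>x. f (?N x))" if "continuous_on I f" for f :: "real \<Rightarrow> real"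
    using KI(1) by (intro continuous_on_compose2[OF that] continuous_intros) auto
  define g' where "g' r = A' r * B r + A r * B' r" for r
  have g': "((\<lambda>r. A r * B r) has_real_derivative g' r) (at r)" if "r \<in> I" for r
    using A'(1)[OF that] B'(1)[OF that] by (auto intro!: derivative_eq_intros simp: g'_def)
  have contg': "continuous_on I g'"
    unfolding g'_def by (intro continuous_intros contAB A'(2) B'(2))
  \<comment> \<open>Adding \<open>B\<^sup>2\<close> cancels the last term of \<open>C\<close> and
    leaves the coefficient of \<open>v\<close> in the divergence for
    \<open>g = A * B\<close>.\<close>
  have C: "C r + (B r)\<^sup>2 = g' r + (real CARD('n) - 1) * (A r * B r / r)" if "r \<in> I" for r
    using assms(4)[of r] DERIV_imp_deriv[OF g'[OF that]] that by (simp add: I_def)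
  note conts = continuous_intros contu contg contr contN[OF contAB(1)] contN[OF contAB(2)]
    contN[OF contg']
  note int = integrable_compact_support[OF K(1)]
  \<comment> \<open>All integrands below vanish off \<open>K\<close>, which lies in the ball, so the
    integrals can be taken over the whole space.\<close>
  have full: "(LINT x:?S|lborel. f x) = (LINT x|lborel. f x)" if "\<And>x. x \<notin> K \<Longrightarrow> f x = 0"
    for f :: "real ^ 'n \<Rightarrow> real"
  proof -
    have "indicator ?S x *\<^sub>R f x = f x" for x
      using that[of x] K(2) by (cases "x \<in> K") (auto simp: indicator_def)
    then show ?thesis by (simp only: set_lebesgue_integral_def)
  qed

  \<comment> \<open>\<open>J\<close> is the integral of the cross term, the same for both
    identities.\<close>
  define J where "J = (LINT x|lborel. A (?N x) * B (?N x) * u x * radial_deriv u x)"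
  have parts: "(LINT x:?S|lborel. (C (?N x) + (B (?N x))\<^sup>2) * \<bar>u x\<bar>\<^sup>2) = - 2 * J"
  proof -
    let ?f = "\<lambda>x. (g' (?N x) + (real CARD('n) - 1) * (A (?N x) * B (?N x) / ?N x)) * (u x)\<^sup>2"
    have "0 = (LINT x|lborel. (g' (?N x) + (real DIM(real ^ 'n) - 1) * (A (?N x) * B (?N x) / ?N x)) * (u x)\<^sup>2
        + A (?N x) * B (?N x) * (2 * u x * D x (x /\<^sub>R ?N x)))"
    \<comment> \<open>The field has \<open>g = A * B\<close> and \<open>v = u\<^sup>2\<close>; the
      chain rule gives the factor \<open>2 * u\<close> that produces \<open>2 * J\<close>.\<close>
    proof (rule integral_radial_divergence_eq_0[where I = I and K = K
          and v' = "\<lambda>x h. 2 * u x * D x h", symmetric])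
      show "K \<subseteq> {x. ?N x \<in> I}" using KI by auto
      show "((\<lambda>x. (u x)\<^sup>2) has_derivative (\<lambda>h. 2 * u x * D x h)) (at x)" for x
        using D[of x] by (auto intro!: derivative_eq_intros)
      show "continuous_on K (\<lambda>x. 2 * u x * D x i)" if "i \<in> Basis" for i
        by (intro conts contD that)
    qed (use K(1) g' contg' u0 in \<open>auto simp: I_def\<close>)
    also have "\<dots> = (LINT x|lborel. ?f x + 2 * (A (?N x) * B (?N x) * u x * radial_deriv u x))"
      by (simp add: rad mult_ac)
    also have "\<dots> = (LINT x|lborel. ?f x) + 2 * J"
      unfolding J_def
    proof (subst Bochner_Integration.integral_add)
      show "integrable lborel ?f"
        using KI u0 by (intro int conts) auto
      show "integrable lborel (\<lambda>x. 2 * (A (?N x) * B (?N x) * u x * radial_deriv u x))"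
        using u0 by (intro int conts) auto
    qed simp
    also have "(LINT x|lborel. ?f x) = (LINT x:?S|lborel. ?f x)"
      using u0 by (intro full[symmetric]) simp
    also have "\<dots> = (LINT x:?S|lborel. (C (?N x) + (B (?N x))\<^sup>2) * \<bar>u x\<bar>\<^sup>2)"
    proof -
      \<comment> \<open>The formula for \<open>C\<close> is available only for radii in
        \<open>I\<close>; off \<open>K\<close> both sides vanish with \<open>u\<close>.\<close>
      have "?f x = (C (?N x) + (B (?N x))\<^sup>2) * \<bar>u x\<bar>\<^sup>2" for x
        using C[OF KI(1), of x] u0[of x] by (cases "x \<in> K") auto
      then show ?thesis by (simp only:)
    qed
    finally show ?thesis by simp
  qed

  have nB: "nB = sqrt (LINT x|lborel. (norm (B (?N x) * u x))\<^sup>2)"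
    unfolding nB_def L2norm_on_def using u0 by (subst full) auto
  have nAR: "nAR = sqrt (LINT x|lborel. (norm (A (?N x) * radial_deriv u x))\<^sup>2)"
    unfolding nAR_def L2norm_on_def using rad0 by (subst full) auto
  have nAG: "nAG = sqrt (LINT x|lborel. (norm (A (?N x) *\<^sub>R grad u x))\<^sup>2)"
    unfolding nAG_def L2norm_on_def using grad0 by (subst full) (auto simp: power_mult_distrib)
  \<comment> \<open>The gradient identity pairs vectors, so \<open>B u\<close> is multiplied by the
    unit vector \<open>x / |x|\<close>. This preserves the norm, also at the origin, where
    \<open>u\<close> is zero.\<close>
  have nB': "nB = sqrt (LINT x|lborel. (norm ((B (?N x) * u x) *\<^sub>R (x /\<^sub>R ?N x)))\<^sup>2)"
  proof -
    have "norm (B (?N x) * u x) = norm ((B (?N x) * u x) *\<^sub>R (x /\<^sub>R ?N x))" for x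
      using u0[of x] KI(2)[of x] by (cases "x \<in> K") (auto simp: abs_mult)
    then show ?thesis unfolding nB by (simp only:)
  qed
  have "nAR * nB = - J + 1 / 2 * (LINT x|lborel. (norm ((sqrt nB / sqrt nAR) *\<^sub>R (A (?N x) * radial_deriv u x)
      + (sqrt nAR / sqrt nB) *\<^sub>R (B (?N x) * u x)))\<^sup>2)"
  proof -
    have J: "J = (LINT x|lborel. (A (?N x) * radial_deriv u x) \<bullet> (B (?N x) * u x))"
      by (simp add: J_def mult_ac)
    show ?thesis
      unfolding J nB nAR
      by (intro L2_product_identity int conts) (auto simp: u0 rad0)
  qed
  moreover have "nAG * nB = - J + 1 / 2 * (LINT x|lborel. (norm ((sqrt nB / sqrt nAG) *\<^sub>R (A (?N x) *\<^sub>R grad u x)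
      + (sqrt nAG / sqrt nB) *\<^sub>R ((B (?N x) * u x) *\<^sub>R (x /\<^sub>R ?N x))))\<^sup>2)"
  proof -
    \<comment> \<open>Pairing the gradient with \<open>x / |x|\<close> yields the radial derivative,
      so the cross term is again \<open>J\<close>.\<close>
    have J: "J = (LINT x|lborel. (A (?N x) *\<^sub>R grad u x) \<bullet> ((B (?N x) * u x) *\<^sub>R (x /\<^sub>R ?N x)))"
      by (simp add: J_def radial_deriv_def inner_commute mult_ac)
    show ?thesis
      unfolding J nB' nAG
      by (intro L2_product_identity int conts) (auto simp: u0 grad0 KI(2))
  qed
  moreover have "(LINT x:?S|lborel. \<bar>sqrt nB / sqrt nAR * A (?N x) * radial_deriv u x
        + sqrt nAR / sqrt nB * B (?N x) * u x\<bar>\<^sup>2)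
      = (LINT x|lborel. (norm ((sqrt nB / sqrt nAR) *\<^sub>R (A (?N x) * radial_deriv u x)
        + (sqrt nAR / sqrt nB) *\<^sub>R (B (?N x) * u x)))\<^sup>2)"
    by (subst full) (auto simp: u0 rad0 mult.assoc)
  moreover have "(LINT x:?S|lborel. (norm ((sqrt nB / sqrt nAG * A (?N x)) *\<^sub>R grad u x
        + (sqrt nAG / sqrt nB * B (?N x) * u x) *\<^sub>R (x /\<^sub>R ?N x)))\<^sup>2)
      = (LINT x|lborel. (norm ((sqrt nB / sqrt nAG) *\<^sub>R (A (?N x) *\<^sub>R grad u x)
        + (sqrt nAG / sqrt nB) *\<^sub>R ((B (?N x) * u x) *\<^sub>R (x /\<^sub>R ?N x))))\<^sup>2)"
    by (subst full) (auto simp: u0 grad0 mult.assoc)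
  \<comment> \<open>The factors on the left of both identities are the norms themselves, so
    \<open>parts\<close> turns \<open>- J\<close> into the integral with
    \<open>C + B\<^sup>2\<close>.\<close>
  moreover have "sqrt (LINT x:?S|lborel. (A (?N x))\<^sup>2 * \<bar>radial_deriv u x\<bar>\<^sup>2) = nAR"
    "sqrt (LINT x:?S|lborel. (A (?N x))\<^sup>2 * (norm (grad u x))\<^sup>2) = nAG"
    "sqrt (LINT x:?S|lborel. (B (?N x))\<^sup>2 * \<bar>u x\<bar>\<^sup>2) = nB"
    by (simp_all add: nAR_def nAG_def nB_def L2norm_on_def power_mult_distrib)
  ultimately show ?thesis
    unfolding parts by simp
qed

end
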